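(* Let $G$ be a graph of order $n$ and minimum degree $\delta(G)$ such that $G \neq K_n$ and $G \neq K_n - M$, where $M$ is a perfect matching of $K_n$ (that is, $G$ is neither isomorphic to the complete graph $K_n$ nor to the graph obtained from $K_n$ by deleting the edges of a perfect matching). Then $rad_p(G) \leq n - \delta(G) - 1$.
   Context: All graphs are finite, simple, undirected and non-empty. For a graph $G$ and $S \subseteq V(G)$, define $P^1_G(S) = N[S]$ (the closed neighbourhood of $S$), and for $i \geq 1$ let $V^i = \{v \in P^i_G(S) : |N[v] \setminus P^i_G(S)| \leq 1\}$ and $P^{i+1}_G(S) = P^i_G(S) \cup N[V^i]$. The set $S$ is a power dominating set (PDS) of $G$ if $P^i_G(S) = V(G)$ for some $i \ge 1$. The power domination number $\gamma_p(G)$ is the minimum cardinality of a PDS of $G$. For a PDS $S$, $rad_p(G,S) = \min\{i \geq 1 : P^i_G(S) = V(G)\}$. The propagation radius of $G$ is $rad_p(G) = \min\{rad_p(G,S) : S \text{ is a PDS of } G \text{ with } |S| = \gamma_p(G)\}$. *)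

theory Defs
  imports "Graph_Theory.Graph_Theory"
begin

text \<open>
  Simple undirected graphs are the library's \<^locale>\<open>graph\<close>s: finite symmetric digraphs without
  loops and parallel arcs. An undirected edge is a pair of opposite arcs, so the degree of
  a vertex is its \<^const>\<open>out_degree\<close>. Non-emptiness is not part of \<^locale>\<open>graph\<close>.
\<close>

definition min_degree :: "('a, 'b) pre_digraph \<Rightarrow> nat" where
  "min_degree G = Min (out_degree G ` verts G)"

definition closed_nbhd :: "('a, 'b) pre_digraph \<Rightarrow> 'a \<Rightarrow> 'a set" where
  "closed_nbhd G v = insert v {w. v \<rightarrow>\<^bsub>G\<^esub> w}"

definition closed_nbhds :: "('a, 'b) pre_digraph \<Rightarrow> 'a set \<Rightarrow> 'a set" where
  "closed_nbhds G S = (\<Union>v\<in>S. closed_nbhd G v)"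

text \<open>
  \<open>observed G S i\<close> is $P^i_G(S)$, indexed from 1 as in the literature. The value at 0 is
  a dummy that is never used: all indices below are constrained to be at least 1.
\<close>

fun observed :: "('a, 'b) pre_digraph \<Rightarrow> 'a set \<Rightarrow> nat \<Rightarrow> 'a set" where
  "observed G S 0 = S"
| "observed G S (Suc 0) = closed_nbhds G S"
| "observed G S (Suc (Suc i)) =
     (let P = observed G S (Suc i)
      in P \<union> closed_nbhds G {v \<in> P. card (closed_nbhd G v - P) \<le> 1})"

definition power_dominating_set :: "('a, 'b) pre_digraph \<Rightarrow> 'a set \<Rightarrow> bool" where
  "power_dominating_set G S \<longleftrightarrow> S \<subseteq> verts G \<and> (\<exists>i\<ge>1. observed G S i = verts G)"

definition power_domination_number :: "('a, 'b) pre_digraph \<Rightarrow> nat" where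
  "power_domination_number G = (LEAST k. \<exists>S. power_dominating_set G S \<and> card S = k)"

definition propagation_radius_of :: "('a, 'b) pre_digraph \<Rightarrow> 'a set \<Rightarrow> nat" where
  "propagation_radius_of G S = (LEAST i. i \<ge> 1 \<and> observed G S i = verts G)"

definition propagation_radius :: "('a, 'b) pre_digraph \<Rightarrow> nat" where
  "propagation_radius G =
     (LEAST r. \<exists>S. power_dominating_set G S \<and> card S = power_domination_number G
                  \<and> propagation_radius_of G S = r)"

text \<open>Each of the minima above is attained in a graph.\<close>

lemma (in wf_digraph) power_dominating_set_verts: "power_dominating_set G (verts G)"
proof -
  have "observed G (verts G) 1 = verts G"
    by (auto simp: closed_nbhds_def closed_nbhd_def arcs_ends_conv)
  then show ?thesis
    unfolding power_dominating_set_def by blast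
qed

lemma propagation_radius_of_attained:
  assumes "power_dominating_set G S"
  shows "propagation_radius_of G S \<ge> 1 \<and> observed G S (propagation_radius_of G S) = verts G"
  using assms LeastI_ex[of "\<lambda>i. i \<ge> 1 \<and> observed G S i = verts G"]
  unfolding power_dominating_set_def propagation_radius_of_def by blast

lemma (in wf_digraph) power_domination_number_attained:
  "\<exists>S. power_dominating_set G S \<and> card S = power_domination_number G"
  unfolding power_domination_number_def
  by (rule LeastI_ex) (use power_dominating_set_verts in blast)

lemma (in wf_digraph) propagation_radius_attained:
  "\<exists>S. power_dominating_set G S \<and> card S = power_domination_number G
     \<and> propagation_radius_of G S = propagation_radius G"
  unfolding propagation_radius_def
  by (rule LeastI_ex) (use power_domination_number_attained in blast)

definition edges :: "('a, 'b) pre_digraph \<Rightarrow> 'a set set" where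
  "edges G = {{u, v} | u v. u \<rightarrow>\<^bsub>G\<^esub> v}"

definition perfect_matching :: "('a, 'b) pre_digraph \<Rightarrow> 'a set set \<Rightarrow> bool" where
  "perfect_matching G M \<longleftrightarrow> M \<subseteq> edges G \<and> (\<forall>v\<in>verts G. \<exists>!e. e \<in> M \<and> v \<in> e)"

definition delete_edges :: "('a, 'b) pre_digraph \<Rightarrow> 'a set set \<Rightarrow> ('a, 'b) pre_digraph" where
  "delete_edges G M = G\<lparr>arcs := {a \<in> arcs G. {tail G a, head G a} \<notin> M}\<rparr>"

text \<open>
  $G \cong K_n - M$. The complete graph ranges over graphs on the vertex type of \<open>G\<close> with pairs
  as arcs; whenever \<open>G\<close> has \<open>n\<close> vertices this type has room for a copy of $K_n$, so no case is lost.
\<close>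

definition complete_minus_perfect_matching :: "nat \<Rightarrow> ('a, 'b) pre_digraph \<Rightarrow> bool" where
  "complete_minus_perfect_matching n G \<longleftrightarrow>
     (\<exists>(K :: ('a, 'a \<times> 'a) pre_digraph) M.
        complete_digraph n K \<and> perfect_matching K M \<and> digraph_iso G (delete_edges K M))"

end

theory Submission
  imports Defs
begin

text \<open>
  Put $k = n - \delta - 1$ and suppose that a minimum power dominating set $S$ needs more than
  $k$ steps. Since $|P^1| \geq \delta + 1$ and every step observes a new vertex, $P^1 = N[v]$
  for a single vertex $v$ and every step adds exactly one vertex: a vertex $f_i$ forces $w_i$
  for $i = 1, \ldots, k$. So $\{v\}$ is a power dominating set as well. If $k = 1$, all degrees
  are $n - 2$ and $G$ is $K_n - M$. If $k \geq 2$, the forcing can be run backwards from $w_k$: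
  the neighbours of $w_k$ lie among $f_k$ and the $\delta$ vertices different from $v$ that
  force nothing, so by the degree bound they are all of these. From $N[w_k]$, the vertex $w_j$
  forces $f_j$ for $j = k - 1, \ldots, 1$. A neighbour of $v$ outside $N[f_1]$ forces $v$ no
  later than $w_1$ forces $f_1$, so $k$ steps suffice. If there is no such neighbour, then
  $N[v] \subseteq N[f_1]$, and starting at $f_1$ instead of $v$ saves a step.
\<close>

section \<open>Monotonicity and stabilisation of the observed sets\<close>

text \<open>The dummy stage 0 does not follow the recursion, so inductions over stages start at
  1.\<close>

lemma observed_Suc:
  assumes "1 \<le> i"
  shows "observed G S (Suc i) =
    observed G S i \<union> closed_nbhds G {v \<in> observed G S i. card (closed_nbhd G v - observed G S i) \<le> 1}"
  using assms by (cases i) (simp_all add: Let_def)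

lemma observed_mono:
  assumes "1 \<le> i" "i \<le> j"
  shows "observed G S i \<subseteq> observed G S j"
  using assms(2,1)
proof (induction j rule: dec_induct)
  case (step m)
  then show ?case using observed_Suc[of m G S] by auto
qed simp

text \<open>From stage 1 on, each stage is computed from its predecessor alone, so a step that adds
  nothing freezes the process.\<close>

lemma observed_eq_of_fixed:
  assumes "1 \<le> i" "observed G S (Suc i) = observed G S i" "i \<le> j"
  shows "observed G S j = observed G S i"
  using assms(3)
proof (induction j rule: dec_induct)
  case (step m)
  then show ?case
    using assms(1,2) observed_Suc[of m G S] observed_Suc[of i G S] by simp
qed simp

text \<open>Stages 1 and 2 are both empty, so the process is frozen there.\<close>

lemma not_power_dominating_empty:
  assumes "verts G \<noteq> {}"
  shows "\<not> power_dominating_set G {}"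
proof -
  have "observed G {} (Suc 0) = {}" "observed G {} (Suc (Suc 0)) = {}"
    by (simp_all add: closed_nbhds_def)
  then have "observed G {} i = {}" if "1 \<le> i" for i
    using observed_eq_of_fixed[of 1 G "{}" i] that by simp
  then show ?thesis using assms by (auto simp: power_dominating_set_def)
qed

lemma propagation_radius_le:
  assumes "S \<subseteq> verts G" "card S = power_domination_number G"
    and "1 \<le> i" "observed G S i = verts G"
  shows "propagation_radius G \<le> i"
proof -
  have "power_dominating_set G S"
    using assms by (auto simp: power_dominating_set_def)
  then have "propagation_radius G \<le> propagation_radius_of G S"
    unfolding propagation_radius_def by (intro Least_le) (use assms(2) in blast)
  also have "\<dots> \<le> i"
    unfolding propagation_radius_of_def by (intro Least_le) (use assms in simp)
  finally show ?thesis .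
qed

section \<open>Closed neighbourhoods and degrees\<close>

context graph
begin

lemma dominates_sym: "u \<rightarrow>\<^bsub>G\<^esub> v \<Longrightarrow> v \<rightarrow>\<^bsub>G\<^esub> u"
  using sym_arcs arcs_ends_symmetric by metis

lemma dominates_verts: "u \<rightarrow>\<^bsub>G\<^esub> v \<Longrightarrow> u \<in> verts G \<and> v \<in> verts G \<and> u \<noteq> v"
  using adj_not_same[of u] by (auto simp: arcs_ends_conv)

lemma closed_nbhd_sym: "u \<in> closed_nbhd G v \<longleftrightarrow> v \<in> closed_nbhd G u"
  by (auto simp: closed_nbhd_def dest: dominates_sym)

lemma closed_nbhd_subset_verts: "v \<in> verts G \<Longrightarrow> closed_nbhd G v \<subseteq> verts G"
  by (auto simp: closed_nbhd_def arcs_ends_conv)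

lemma self_in_closed_nbhd: "v \<in> closed_nbhd G v"
  by (simp add: closed_nbhd_def)

lemma finite_closed_nbhd: "finite (closed_nbhd G v)"
proof -
  have "{w. v \<rightarrow>\<^bsub>G\<^esub> w} \<subseteq> verts G" by (auto simp: arcs_ends_conv)
  then show ?thesis
    unfolding closed_nbhd_def using finite_subset[OF _ finite_verts] by simp
qed

text \<open>Without parallel arcs, \<open>head\<close> is injective on the arcs leaving
  \<open>v\<close>; without loops, \<open>v\<close> itself is the one extra element.\<close>

lemma card_closed_nbhd: "card (closed_nbhd G v) = Suc (out_degree G v)"
proof -
  have "bij_betw (head G) (out_arcs G v) {w. v \<rightarrow>\<^bsub>G\<^esub> w}"
    unfolding bij_betw_def
  proof
    show "inj_on (head G) (out_arcs G v)"
      by (rule inj_onI) (auto simp: out_arcs_def arc_to_ends_def intro!: no_multi_arcs)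
    show "head G ` out_arcs G v = {w. v \<rightarrow>\<^bsub>G\<^esub> w}"
      by (force simp: out_arcs_def arcs_ends_conv)
  qed
  then have "card {w. v \<rightarrow>\<^bsub>G\<^esub> w} = out_degree G v"
    by (simp add: bij_betw_same_card out_degree_def)
  moreover have "v \<notin> {w. v \<rightarrow>\<^bsub>G\<^esub> w}" using adj_not_same by blast
  moreover have "finite {w. v \<rightarrow>\<^bsub>G\<^esub> w}"
    using finite_closed_nbhd[of v] by (simp add: closed_nbhd_def)
  ultimately show ?thesis by (simp add: closed_nbhd_def)
qed

lemma min_degree_lt_card_closed_nbhd:
  assumes "v \<in> verts G"
  shows "min_degree G < card (closed_nbhd G v)"
proof -
  have "min_degree G \<le> out_degree G v"
    unfolding min_degree_def using assms by (intro Min_le) auto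
  then show ?thesis by (simp add: card_closed_nbhd)
qed

section \<open>Growth of the observed sets\<close>

lemma closed_nbhds_subset_verts: "S \<subseteq> verts G \<Longrightarrow> closed_nbhds G S \<subseteq> verts G"
  using closed_nbhd_subset_verts by (auto simp: closed_nbhds_def)

lemma observed_subset_verts:
  assumes "S \<subseteq> verts G"
  shows "observed G S i \<subseteq> verts G"
proof (induction i)
  case 0
  then show ?case using assms by simp
next
  case (Suc i)
  show ?case
  proof (cases "i = 0")
    case True
    then show ?thesis using assms closed_nbhds_subset_verts by simp
  next
    case False
    have "closed_nbhds G {v \<in> observed G S i. card (closed_nbhd G v - observed G S i) \<le> 1} \<subseteq> verts G"
      using Suc by (intro closed_nbhds_subset_verts) auto
    then show ?thesis using False Suc observed_Suc[of i G S] by auto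
  qed
qed

lemma observed_force:
  assumes "1 \<le> i" "v \<in> observed G S i" "closed_nbhd G v \<subseteq> insert w (observed G S i)"
  shows "closed_nbhd G v \<subseteq> observed G S (Suc i)"
proof -
  have "closed_nbhd G v - observed G S i \<subseteq> {w}" using assms(3) by blast
  then have "card (closed_nbhd G v - observed G S i) \<le> 1"
    using card_mono[of "{w}"] by fastforce
  then show ?thesis
    using assms observed_Suc[of i G S] by (auto simp: closed_nbhds_def)
qed

text \<open>A larger observed set leaves each vertex no more unobserved neighbours, so an inclusion
  between two runs persists. Separate offsets \<open>i\<close> and \<open>j\<close> allow one run to
  be a step ahead of the other.\<close>

lemma observed_subset_shift:
  assumes "1 \<le> i" "1 \<le> j" "observed G A i \<subseteq> observed G B j"
  shows "observed G A (i + m) \<subseteq> observed G B (j + m)"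
proof (induction m)
  case 0
  then show ?case using assms by simp
next
  case (Suc m)
  let ?A = "observed G A (i + m)" and ?B = "observed G B (j + m)"
  have "card (closed_nbhd G v - ?B) \<le> card (closed_nbhd G v - ?A)" for v
    using Suc finite_closed_nbhd by (intro card_mono) auto
  then have "card (closed_nbhd G v - ?B) \<le> 1" if "card (closed_nbhd G v - ?A) \<le> 1" for v
    using that le_trans by blast
  then show ?case
    using assms(1,2) Suc observed_Suc[of "i + m" G A] observed_Suc[of "j + m" G B]
    by (auto simp: closed_nbhds_def)
qed

lemma observed_cong:
  assumes "observed G A 1 = observed G B 1" "1 \<le> i"
  shows "observed G A i = observed G B i"
  using observed_subset_shift[of 1 1 A B "i - 1"] observed_subset_shift[of 1 1 B A "i - 1"] assms
  by auto

text \<open>If a step from a stage up to \<open>k\<close> added nothing, the process would be frozen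
  before all vertices are observed. So each such step adds at least one vertex.\<close>

lemma card_observed_growth:
  assumes "power_dominating_set G S" "observed G S k \<noteq> verts G"
    and "1 \<le> i" "i \<le> j" "j \<le> Suc k"
  shows "card (observed G S i) + (j - i) \<le> card (observed G S j)"
  using assms(4,5)
proof (induction j rule: dec_induct)
  case (step m)
  have S: "S \<subseteq> verts G" and "\<exists>r\<ge>1. observed G S r = verts G"
    using assms(1) by (auto simp: power_dominating_set_def)
  then obtain r where r: "1 \<le> r" "observed G S r = verts G" by blast
  have m: "1 \<le> m" "m \<le> k" using step assms(3) by auto
  have "observed G S m \<noteq> observed G S (Suc m)"
  proof
    assume eq: "observed G S m = observed G S (Suc m)"
    have "observed G S (max k r) = observed G S k"
      using observed_eq_of_fixed[OF m(1) eq[symmetric], of "max k r"]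
        observed_eq_of_fixed[OF m(1) eq[symmetric], of k] m by simp
    moreover have "observed G S (max k r) = verts G"
      using observed_mono[of r "max k r" G S] observed_subset_verts[OF S, of "max k r"] r
      by (metis max.cobounded2 subset_antisym)
    ultimately show False using assms(2) by simp
  qed
  then have "observed G S m \<subset> observed G S (Suc m)"
    using observed_mono[of m "Suc m" G S] m by auto
  then have "card (observed G S m) < card (observed G S (Suc m))"
    using finite_subset[OF observed_subset_verts[OF S] finite_verts] by (intro psubset_card_mono)
  then show ?case using step by simp
qed simp

text \<open>The count is tight: stage 1 has at least \<open>min_degree G + 1\<close> vertices, each
  of the next \<open>k\<close> steps adds at least one, and this already amounts to the order of
  \<open>G\<close>. So all these inequalities are equalities.\<close>

lemma slow_power_dominating_set:
  assumes pds: "power_dominating_set G S" and "verts G \<noteq> {}"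
    and "1 \<le> k" "observed G S k \<noteq> verts G"
    and n: "card (verts G) = k + min_degree G + 1"
  shows slow_card: "\<And>i. \<lbrakk>1 \<le> i; i \<le> Suc k\<rbrakk> \<Longrightarrow> card (observed G S i) = min_degree G + i"
    and slow_singleton: "\<exists>v \<in> verts G. observed G S 1 = closed_nbhd G v"
proof -
  have S: "S \<subseteq> verts G" using pds by (simp add: power_dominating_set_def)
  have fin: "finite (observed G S i)" for i
    using finite_subset[OF observed_subset_verts[OF S] finite_verts] .
  have "S \<noteq> {}"
    using pds not_power_dominating_empty[OF \<open>verts G \<noteq> {}\<close>] by metis
  then obtain v where v: "v \<in> S" by blast
  have sub: "closed_nbhd G v \<subseteq> observed G S 1"
    using v by (auto simp: closed_nbhds_def)
  have deg: "min_degree G < card (closed_nbhd G v)"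
    using v S by (intro min_degree_lt_card_closed_nbhd) blast
  have lower: "min_degree G + 1 \<le> card (observed G S 1)"
    using deg card_mono[OF fin sub] by simp
  have upper: "card (observed G S (Suc k)) \<le> k + min_degree G + 1"
    using card_mono[OF finite_verts observed_subset_verts[OF S, of "Suc k"]] unfolding n .
  show card_eq: "card (observed G S i) = min_degree G + i" if "1 \<le> i" "i \<le> Suc k" for i
  proof -
    have "card (observed G S 1) + (i - 1) \<le> card (observed G S i)"
      using card_observed_growth[OF pds assms(4) order_refl that] .
    moreover have "card (observed G S i) + (Suc k - i) \<le> card (observed G S (Suc k))"
      using card_observed_growth[OF pds assms(4) that order_refl] .
    ultimately show ?thesis using lower upper that by linarith
  qed
  have "closed_nbhd G v = observed G S 1"
    using deg card_eq[of 1] by (intro card_seteq[OF fin sub]) simp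
  then show "\<exists>v \<in> verts G. observed G S 1 = closed_nbhd G v"
    using v S by blast
qed

section \<open>Running the forcing process backwards\<close>

text \<open>The reversed run is inspected at stage \<open>k - 1\<close>, which has to be at least 1;
  hence the bound 2 on \<open>k\<close>.\<close>

lemma faster_singleton:
  assumes v: "v \<in> verts G" and pds: "power_dominating_set G {v}"
    and k: "2 \<le> k" and slow: "observed G {v} k \<noteq> verts G"
    and n: "card (verts G) = k + min_degree G + 1"
  shows "\<exists>s \<in> verts G. observed G {s} k = verts G"
proof -
  define P where "P = observed G {v}"
  have P1: "P 1 = closed_nbhd G v" by (simp add: P_def closed_nbhds_def)
  have P_verts: "P i \<subseteq> verts G" for i
    unfolding P_def using observed_subset_verts v by simp
  have P_fin: "finite (P i)" for i
    using P_verts finite_verts finite_subset by blast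
  have P_mono: "P i \<subseteq> P j" if "1 \<le> i" "i \<le> j" for i j
    using observed_mono[OF that] by (simp add: P_def)
  have P_card: "card (P i) = min_degree G + i" if "1 \<le> i" "i \<le> Suc k" for i
    unfolding P_def using v k by (intro slow_card[OF pds _ _ slow n] that) auto
  have P_last: "P (Suc k) = verts G"
    using card_seteq[OF finite_verts P_verts, of "Suc k"] P_card[of "Suc k"] n by simp
  \<comment> \<open>By the tight count the step adds a single vertex \<open>w\<close>;
    \<open>f\<close> is an observed vertex whose closed neighbourhood brought it in.\<close>
  have "\<exists>f w. f \<in> P i \<and> w \<in> closed_nbhd G f \<and> w \<notin> P i \<and> closed_nbhd G f \<subseteq> insert w (P i)
      \<and> P (Suc i) = insert w (P i)" if i: "1 \<le> i" "i \<le> k" for i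
  proof -
    have "card (P (Suc i) - P i) = 1"
      using P_card[of i] P_card[of "Suc i"] i P_mono[of i "Suc i"] P_fin
      by (simp add: card_Diff_subset)
    then obtain w where w: "P (Suc i) - P i = {w}" by (auto simp: card_1_singleton_iff)
    then obtain f where f: "f \<in> P i" "card (closed_nbhd G f - P i) \<le> 1" "w \<in> closed_nbhd G f"
      using observed_Suc[of i G "{v}"] i unfolding P_def by (auto simp: closed_nbhds_def)
    have "closed_nbhd G f - P i \<subseteq> {w}"
      using f w card_le_Suc0_iff_eq[of "closed_nbhd G f - P i"] finite_closed_nbhd[of f] by auto
    moreover have "P (Suc i) = insert w (P i)"
      using w P_mono[of i "Suc i"] i by auto
    ultimately show ?thesis using f w by (intro exI[of _ f] exI[of _ w]) auto
  qed
  then obtain f w where fw: "\<And>i. 1 \<le> i \<Longrightarrow> i \<le> k \<Longrightarrow> f i \<in> P i \<and> w i \<in> closed_nbhd G (f i) \<and> w i \<notin> P i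
      \<and> closed_nbhd G (f i) \<subseteq> insert (w i) (P i) \<and> P (Suc i) = insert (w i) (P i)"
    by metis
  have f_nbhd: "closed_nbhd G (f i) \<subseteq> P j" if "1 \<le> i" "i < j" "j \<le> k" for i j
    using fw[of i] P_mono[of "Suc i" j] that by auto
  show ?thesis
  proof (cases "closed_nbhd G v \<subseteq> closed_nbhd G (f 1)")
    case True
    \<comment> \<open>Stage 2 from \<open>v\<close> adds only \<open>w 1\<close>, a neighbour of
      \<open>f 1\<close>. So the run from \<open>f 1\<close> is one step ahead.\<close>
    have "P 2 \<subseteq> closed_nbhd G (f 1)"
      using True fw[of 1] k P1 by (auto simp: numeral_2_eq_2)
    then have "observed G {v} 2 \<subseteq> observed G {f 1} 1"
      by (simp add: P_def closed_nbhds_def)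
    then have "observed G {v} (2 + (k - 1)) \<subseteq> observed G {f 1} (1 + (k - 1))"
      by (intro observed_subset_shift) auto
    then have "verts G \<subseteq> observed G {f 1} k"
      using P_last k by (simp add: P_def)
    moreover have "f 1 \<in> verts G" using fw[of 1] k P_verts by auto
    ultimately show ?thesis using observed_subset_verts[of "{f 1}" k] by blast
  next
    case False
    then obtain x where x: "x \<in> closed_nbhd G v" "x \<notin> closed_nbhd G (f 1)" by blast
    have vP: "v \<in> P i" if "1 \<le> i" for i
      using P1 P_mono[OF order_refl that] self_in_closed_nbhd by auto
    have f_inj: "inj_on f {1..k}"
    proof (rule linorder_inj_onI')
      fix i j assume ij: "i \<in> {1..k}" "j \<in> {1..k}" "i < j"
      then have "w j \<in> closed_nbhd G (f j) - P j" using fw by simp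
      moreover have "closed_nbhd G (f i) \<subseteq> P j" using f_nbhd ij by simp
      ultimately show "f i \<noteq> f j" by auto
    qed
    \<comment> \<open>The closed neighbourhood of \<open>v\<close> is stage 1, so \<open>v\<close>
      has nothing left to force.\<close>
    have f_ne_v: "f i \<noteq> v" if "1 \<le> i" "i \<le> k" for i
      using fw[OF that] P_mono[of 1 i] that P1 by auto
    have w_verts: "w i \<in> verts G" if "1 \<le> i" "i \<le> k" for i
      using fw[OF that] P_verts[of "Suc i"] by auto
    \<comment> \<open>Otherwise \<open>w j\<close> would have been observed by the time \<open>u\<close> had forced.\<close>
    have w_nonadj: "u \<noteq> v \<and> u \<notin> f ` {1..<j}"
      if "u \<in> closed_nbhd G (w j)" "1 \<le> j" "j \<le> k" for u j
    proof -
      have "w j \<in> closed_nbhd G u" using that closed_nbhd_sym by blast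
      moreover have "w j \<notin> closed_nbhd G v" using fw[of j] P_mono[of 1 j] P1 that by auto
      moreover have "w j \<notin> closed_nbhd G (f m)" if "1 \<le> m" "m < j" for m
        using fw[of j] f_nbhd[of m j] that \<open>j \<le> k\<close> by auto
      ultimately show ?thesis by auto
    qed
    \<comment> \<open>The vertex \<open>f m\<close> is observed at stage \<open>m\<close>, hence at
      stage \<open>j\<close>, when \<open>w j\<close> is still missing.\<close>
    have w_ne_f: "w j \<notin> f ` {1..j}" if "1 \<le> j" "j \<le> k" for j
    proof
      assume "w j \<in> f ` {1..j}"
      then obtain m where m: "1 \<le> m" "m \<le> j" "w j = f m" by auto
      then show False using fw[of j] fw[of m] P_mono[of m j] that by auto
    qed
    \<comment> \<open>\<open>T\<close> collects the vertices never chosen to force. As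
      \<open>f\<close> is injective, there are \<open>min_degree G + 1\<close> of them,
      \<open>v\<close> included.\<close>
    define T where "T = verts G - f ` {1..k}"
    have "f ` {1..k} \<subseteq> verts G" using fw P_verts by fastforce
    then have "card T = min_degree G + 1"
      unfolding T_def using f_inj n by (simp add: card_Diff_subset card_image)
    moreover have "v \<in> T" using v f_ne_v by (fastforce simp: T_def)
    ultimately have cardT: "card (T - {v}) = min_degree G" by simp
    have finT: "finite (T - {v})" using finite_verts by (simp add: T_def)
    \<comment> \<open>\<open>w_nonadj\<close> gives one inclusion; the degree bound at
      \<open>w k\<close> turns it into an equality by counting.\<close>
    have N_last: "closed_nbhd G (w k) = insert (f k) (T - {v})"
    proof (rule card_seteq)
      show "closed_nbhd G (w k) \<subseteq> insert (f k) (T - {v})"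
      proof
        fix u assume u: "u \<in> closed_nbhd G (w k)"
        have "u \<in> verts G" using u closed_nbhd_subset_verts w_verts[of k] k by auto
        moreover have "u \<noteq> v" "u \<notin> f ` {1..<k}" using w_nonadj[OF u] k by auto
        moreover have "{1..k} = insert k {1..<k}" using k by auto
        ultimately show "u \<in> insert (f k) (T - {v})" by (auto simp: T_def)
      qed
      have "card (insert (f k) (T - {v})) \<le> min_degree G + 1"
        using cardT finT by (simp add: card_insert_if)
      then show "card (insert (f k) (T - {v})) \<le> card (closed_nbhd G (w k))"
        using min_degree_lt_card_closed_nbhd[of "w k"] w_verts[of k] k by linarith
    qed (use finT in simp)
    define Q where "Q = observed G {w k}"
    have Q_mono: "Q i \<subseteq> Q (Suc i)" if "1 \<le> i" for i
      using observed_mono[OF that, of "Suc i"] by (simp add: Q_def)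
    have Q_force: "closed_nbhd G y \<subseteq> Q (Suc i)"
      if "1 \<le> i" "y \<in> Q i" "closed_nbhd G y \<subseteq> insert z (Q i)" for y z i
      using observed_force[of i] that unfolding Q_def by blast
    \<comment> \<open>Invariant of the reversed run: \<open>f k\<close>, \<open>f (k - 1)\<close>
      and so on are recovered in this order, while \<open>v\<close> is left aside.\<close>
    have Q_lower: "verts G - {v} - f ` {1..k - i} \<subseteq> Q i" if "1 \<le> i" "i \<le> k" for i
      using that
    proof (induction i rule: dec_induct)
      case base
      have "{1..k} = insert k {1..k - 1}" using k by auto
      moreover have "Q 1 = insert (f k) (T - {v})"
        using N_last by (simp add: Q_def closed_nbhds_def)
      ultimately show ?case by (auto simp: T_def)
    next
      case (step i)
      \<comment> \<open>It is the turn of \<open>w j\<close>: it is not adjacent to \<open>v\<close>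
        or to any \<open>f\<close> of smaller index, and those of larger index are observed, so only
        \<open>f j\<close> can be missing.\<close>
      define j where "j = k - i"
      have j: "1 \<le> j" "j \<le> k" using step by (auto simp: j_def)
      have IH: "verts G - {v} - f ` {1..j} \<subseteq> Q i" using step by (simp add: j_def)
      have "w j \<noteq> v" using fw[of j] vP[of j] j by auto
      then have wj: "w j \<in> Q i" using IH w_ne_f[OF j] w_verts[OF j] by blast
      have split: "{1..j} = insert j {1..<j}" using j by auto
      have "closed_nbhd G (w j) \<subseteq> insert (f j) (Q i)"
      proof
        fix u assume u: "u \<in> closed_nbhd G (w j)"
        then have "u \<in> verts G" using closed_nbhd_subset_verts w_verts[OF j] by auto
        then show "u \<in> insert (f j) (Q i)" using IH w_nonadj[OF u j] split by auto
      qed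
      then have "f j \<in> Q (Suc i)"
        using Q_force[OF step(1) wj] fw[OF j] closed_nbhd_sym by blast
      moreover have "{1..j} = insert j {1..k - Suc i}" using j by (auto simp: j_def)
      ultimately show ?case using IH Q_mono[OF step(1)] by auto
    qed
    have k1: "1 \<le> k - 1" "Suc (k - 1) = k" using k by auto
    have "k - (k - 1) = 1" using k by simp
    then have penult: "verts G - {v, f 1} \<subseteq> Q (k - 1)" using Q_lower[of "k - 1"] k1 by auto
    have "f 1 \<in> closed_nbhd G v" using fw[of 1] k P1 by simp
    then have x_ne: "x \<noteq> v" "x \<noteq> f 1"
      using x self_in_closed_nbhd closed_nbhd_sym by metis+
    have x_verts: "x \<in> verts G" using x v closed_nbhd_subset_verts by blast
    \<comment> \<open>By its choice \<open>x\<close> avoids \<open>f 1\<close>, the other vertex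
      that may be missing. So \<open>x\<close> forces \<open>v\<close> by stage \<open>k\<close>,
      the stage by which \<open>w 1\<close> forces \<open>f 1\<close>.\<close>
    have N_x: "closed_nbhd G x \<subseteq> insert v (Q (k - 1))"
    proof
      fix u assume u: "u \<in> closed_nbhd G x"
      then have "u \<noteq> f 1" using x(2) closed_nbhd_sym by blast
      moreover have "u \<in> verts G" using u closed_nbhd_subset_verts x_verts by auto
      ultimately show "u \<in> insert v (Q (k - 1))" using penult by auto
    qed
    have "x \<in> Q (k - 1)" using penult x_ne x_verts by auto
    then have "closed_nbhd G x \<subseteq> Q k" using Q_force[OF k1(1) _ N_x] k1(2) by simp
    then have "v \<in> Q k" using x(1) closed_nbhd_sym by auto
    moreover have "verts G - {v} \<subseteq> Q k" using Q_lower[of k] k by simp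
    ultimately have "verts G \<subseteq> Q k" by blast
    moreover have "Q k \<subseteq> verts G"
      unfolding Q_def using observed_subset_verts w_verts[of k] k by simp
    ultimately show ?thesis using w_verts[of k] k unfolding Q_def by auto
  qed
qed

section \<open>The two excluded graphs\<close>

lemma complete_digraph_of_full_nbhds:
  assumes "\<And>v. v \<in> verts G \<Longrightarrow> closed_nbhd G v = verts G"
  shows "complete_digraph (card (verts G)) G"
proof -
  have "u \<rightarrow>\<^bsub>G\<^esub> v" if "u \<in> verts G" "v \<in> verts G" "u \<noteq> v" for u v
    using that assms[of u] by (auto simp: closed_nbhd_def set_eq_iff)
  then have "(u, v) \<in> arcs_ends G \<longleftrightarrow> u \<in> verts G \<and> v \<in> verts G \<and> u \<noteq> v" for u v
    using dominates_verts by blast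
  then have "arcs_ends G = {(u, v). (u, v) \<in> verts G \<times> verts G \<and> u \<noteq> v}"
    by (simp add: set_eq_iff)
  then show ?thesis
    unfolding complete_digraph_def using graph_axioms by simp
qed

text \<open>Non-adjacency is symmetric, so vertices with exactly one non-neighbour each are paired
  off by it; these pairs form the matching.\<close>

lemma complete_minus_perfect_matching_of_nbhds:
  assumes miss: "\<And>v. v \<in> verts G \<Longrightarrow> card (verts G - closed_nbhd G v) = 1"
  shows "complete_minus_perfect_matching (card (verts G)) G"
proof -
  \<comment> \<open>The complete graph is built on the vertices of \<open>G\<close> itself, so that
    the isomorphism can fix every vertex.\<close>
  define K :: "('a, 'a \<times> 'a) pre_digraph" where
    "K = \<lparr>verts = verts G, arcs = {(u, v). u \<in> verts G \<and> v \<in> verts G \<and> u \<noteq> v},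
      tail = fst, head = snd\<rparr>"
  define M where "M = {{u, v} | u v. u \<in> verts G \<and> v \<in> verts G - closed_nbhd G u}"
  have endsK: "arcs_ends K = {(u, v). u \<in> verts G \<and> v \<in> verts G \<and> u \<noteq> v}"
    by (auto simp: arcs_ends_conv K_def)
  have "arcs K \<subseteq> verts G \<times> verts G" by (auto simp: K_def)
  then have "finite (arcs K)" using finite_subset finite_verts by blast
  then have "graph K"
    using finite_verts
    by unfold_locales (auto simp: K_def arc_to_ends_def symmetric_conv)
  then have "complete_digraph (card (verts G)) K"
    unfolding complete_digraph_def endsK by (auto simp: K_def)
  moreover have "perfect_matching K M"
    unfolding perfect_matching_def
  proof (intro conjI ballI)
    show "M \<subseteq> edges K"
      using self_in_closed_nbhd by (force simp: M_def edges_def endsK)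
  next
    fix v assume "v \<in> verts K"
    then have v: "v \<in> verts G" by (simp add: K_def)
    then obtain w where w: "verts G - closed_nbhd G v = {w}"
      using miss by (auto simp: card_1_singleton_iff)
    show "\<exists>!e. e \<in> M \<and> v \<in> e"
    proof
      show "{v, w} \<in> M \<and> v \<in> {v, w}" using v w by (auto simp: M_def)
    next
      fix e assume "e \<in> M \<and> v \<in> e"
      then obtain a b where e: "e = {a, b}" "a \<in> verts G" "b \<in> verts G" "b \<notin> closed_nbhd G a" "v \<in> {a, b}"
        unfolding M_def by blast
      \<comment> \<open>The vertex \<open>v\<close> may be either end of \<open>e\<close>; this
        covers the case \<open>v = b\<close>.\<close>
      moreover have "a \<notin> closed_nbhd G b" using e(4) closed_nbhd_sym by blast
      ultimately show "e = {v, w}" using w by auto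
    qed
  qed
  moreover have "digraph_iso G (delete_edges K M)"
  proof -
    \<comment> \<open>Each arc goes to its pair of ends, injectively because there are no parallel
      arcs.\<close>
    let ?f = "\<lparr>iso_verts = id, iso_arcs = arc_to_ends G, iso_head = snd, iso_tail = fst\<rparr>
      :: ('a, 'b, 'a, 'a \<times> 'a) digraph_isomorphism"
    have iso: "digraph_isomorphism ?f"
      unfolding digraph_isomorphism_def
      using wf_digraph inj_on_arc_to_ends by (auto simp: arc_to_ends_def)
    have M_iff: "{u, v} \<notin> M \<longleftrightarrow> u \<rightarrow>\<^bsub>G\<^esub> v" if "u \<in> verts G" "v \<in> verts G" "u \<noteq> v" for u v
    proof -
      have "{u, v} \<in> M \<longleftrightarrow> v \<notin> closed_nbhd G u"
      proof
        assume "{u, v} \<in> M"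
        then obtain a b where ab: "{u, v} = {a, b}" "b \<notin> closed_nbhd G a"
          by (auto simp: M_def)
        then have "u = a \<and> v = b \<or> u = b \<and> v = a" by (simp only: doubleton_eq_iff)
        then show "v \<notin> closed_nbhd G u" using ab(2) closed_nbhd_sym[of a b] by auto
      next
        assume "v \<notin> closed_nbhd G u"
        then show "{u, v} \<in> M" using that by (auto simp: M_def)
      qed
      then show ?thesis using that by (simp add: closed_nbhd_def)
    qed
    have "u \<rightarrow>\<^bsub>G\<^esub> v \<longleftrightarrow> u \<in> verts G \<and> v \<in> verts G \<and> u \<noteq> v \<and> {u, v} \<notin> M" for u v
      using dominates_verts[of u v] M_iff[of u v] by auto
    then have "arcs (delete_edges K M) = arcs_ends G"
      by (auto simp: delete_edges_def K_def)
    then have "delete_edges K M = app_iso ?f G"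
      by (simp add: app_iso_def delete_edges_def K_def arcs_ends_def)
    then show ?thesis using iso unfolding digraph_iso_def by blast
  qed
  ultimately show ?thesis unfolding complete_minus_perfect_matching_def by blast
qed

section \<open>Power domination by a single vertex\<close>

lemma power_domination_number_eq_1:
  assumes "power_dominating_set G {v}" "verts G \<noteq> {}"
  shows "power_domination_number G = 1"
proof -
  have "power_domination_number G \<le> 1"
    unfolding power_domination_number_def using assms(1) by (intro Least_le) force
  moreover obtain S where S: "power_dominating_set G S" "card S = power_domination_number G"
    using power_domination_number_attained by blast
  then have "S \<noteq> {}" "finite S"
    using not_power_dominating_empty[OF assms(2)] finite_subset[OF _ finite_verts]
    by (metis, simp add: power_dominating_set_def)
  then have "power_domination_number G \<noteq> 0" using S(2) by auto
  ultimately show ?thesis by simp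
qed

lemma propagation_radius_le_of_vertex:
  assumes "s \<in> verts G" "1 \<le> i" "observed G {s} i = verts G"
  shows "propagation_radius G \<le> i"
proof -
  have "power_dominating_set G {s}" using assms by (auto simp: power_dominating_set_def)
  then show ?thesis
    using propagation_radius_le[of "{s}" G i] power_domination_number_eq_1[of s] assms
    by fastforce
qed

end

theorem theorem3p3:
  fixes G :: "('a, 'b) pre_digraph" and n :: nat
  assumes "graph G"
    and "verts G \<noteq> {}"
    and "card (verts G) = n"
    and "\<not> complete_digraph n G"
    and "\<not> complete_minus_perfect_matching n G"
  shows "int (propagation_radius G) \<le> int n - int (min_degree G) - 1"
proof -
  interpret graph G by fact
  have deg: "min_degree G < card (closed_nbhd G v)" "card (closed_nbhd G v) \<le> n"
    if "v \<in> verts G" for v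
    using that min_degree_lt_card_closed_nbhd card_mono[OF finite_verts closed_nbhd_subset_verts]
      assms(3) by auto
  have full: "closed_nbhd G v = verts G" if "v \<in> verts G" "card (closed_nbhd G v) = n" for v
    using card_subset_eq[OF finite_verts closed_nbhd_subset_verts] that assms(3) by simp
  obtain v0 where "v0 \<in> verts G" using assms(2) by blast
  then have "min_degree G < n" using deg[of v0] by linarith
  moreover have "min_degree G + 1 \<noteq> n"
  proof
    assume "min_degree G + 1 = n"
    then have "closed_nbhd G v = verts G" if "v \<in> verts G" for v
      using full[OF that] deg[OF that] by linarith
    then show False using complete_digraph_of_full_nbhds assms(3,4) by blast
  qed
  moreover define k where "k = n - min_degree G - 1"
  ultimately have k: "1 \<le> k" and n: "card (verts G) = k + min_degree G + 1"
    using assms(3) by auto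
  have "propagation_radius G \<le> k"
  proof (rule ccontr)
    assume large: "\<not> propagation_radius G \<le> k"
    then have slow: "observed G {s} k \<noteq> verts G" if "s \<in> verts G" for s
      using propagation_radius_le_of_vertex[OF that k] by blast
    obtain S where S: "power_dominating_set G S" "card S = power_domination_number G"
      using power_domination_number_attained by blast
    then have "observed G S k \<noteq> verts G"
      using propagation_radius_le[of S G k] k large by (auto simp: power_dominating_set_def)
    then obtain v where v: "v \<in> verts G" "observed G S 1 = closed_nbhd G v"
      using slow_singleton[OF S(1) assms(2) k _ n] by blast
    then have "observed G S 1 = observed G {v} 1" by (simp add: closed_nbhds_def)
    \<comment> \<open>Stage 1 determines all later stages, so \<open>{v}\<close> inherits the whole
      run of \<open>S\<close>.\<close>
    then have "observed G S i = observed G {v} i" if "1 \<le> i" for i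
      using observed_cong that by blast
    then have pds: "power_dominating_set G {v}"
      using S(1) v(1) by (auto simp: power_dominating_set_def)
    have "k \<noteq> 1"
    proof
      assume "k = 1"
      \<comment> \<open>For \<open>k = 1\<close>, slowness says that no vertex is adjacent to all
        others, and the degree bound allows only one non-neighbour.\<close>
      have "card (verts G - closed_nbhd G u) = 1" if u: "u \<in> verts G" for u
      proof -
        have "closed_nbhd G u \<noteq> verts G"
          using slow[OF u] \<open>k = 1\<close> by (auto simp: closed_nbhds_def)
        then have "card (closed_nbhd G u) = n - 1"
          using full[OF u] deg[OF u] n \<open>k = 1\<close> assms(3) by fastforce
        then show ?thesis
          using card_Diff_subset[OF finite_closed_nbhd closed_nbhd_subset_verts[OF u]] n assms(3)
          by simp
      qed
      then show False using complete_minus_perfect_matching_of_nbhds assms(3,5) by blast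
    qed
    then have "2 \<le> k" using k by simp
    then show False using faster_singleton[OF v(1) pds _ slow[OF v(1)] n] slow by blast
  qed
  then show ?thesis using n assms(3) by linarith
qed

end
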